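(* Let $((A,\cdot,\delta),f,g)$ be a commutative and cocommutative Nijenhuis associative D-bialgebra over $K$. Define $[x,y]_{(f,g)}:=x\cdot f(y)+g(x\cdot y)$ and $\Delta_{(g,f)}(x):=x_{[1]}\otimes g(x_{[2]})+f(x)_{[1]}\otimes f(x)_{[2]}$. If $f\circ g=g\circ f$, then $((A,[,]_{(f,g)},\Delta_{(g,f)}),f,g)$ is a Nijenhuis (special) left Alia bialgebra.
   Context: All vector spaces are over a field $K$ of characteristic zero. Sweedler notation without summation sign: $\delta(x)=x_{[1]}\otimes x_{[2]}$, $\Delta(x)=x_{(1)}\otimes x_{(2)}$; e.g. $f(x)_{[1]}\otimes f(x)_{[2]}=\delta(f(x))$. $\tau$ is the flip map. No unit or counit is assumed. A Nijenhuis operator on an algebra $(A,\diamond)$ is a linear map $N$ with $N(x)\diamond N(y)+N^2(x\diamond y)=N(N(x)\diamond y+x\diamond N(y))$. A Nijenhuis operator on a space $A$ with comultiplication $\Delta$ is a linear map $S$ with $S(x_{(1)})\otimes S(x_{(2)})+S^2(x)_{(1)}\otimes S^2(x)_{(2)}=S(S(x)_{(1)})\otimes S(x)_{(2)}+S(x)_{(1)}\otimes S(S(x)_{(2)})$ (same for $\delta$). A commutative and cocommutative associative D-bialgebra is $(A,\cdot,\delta)$ with $(A,\cdot)$ commutative associative, $(A,\delta)$ cocommutative coassociative, and $\delta(a\cdot b)=a_{[1]}\cdot b\otimes a_{[2]}+b_{[1]}\otimes a\cdot b_{[2]}$. A commutative and cocommutative Nijenhuis associative D-bialgebra $((A,\cdot,\delta),N,S)$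 is such a bialgebra with linear maps $N,S:A\to A$ such that $N$ is a Nijenhuis operator on $(A,\cdot)$, $S$ is a Nijenhuis operator on $(A,\delta)$, and for all $x,y\in A$ $$S(N(x)\cdot y)+x\cdot S^2(y)=N(x)\cdot S(y)+S(x\cdot S(y)),$$ $$S(N(x)_{[1]})\otimes N(x)_{[2]}+x_{[1]}\otimes N^2(x_{[2]})=S(x_{[1]})\otimes N(x_{[2]})+N(x)_{[1]}\otimes N(N(x)_{[2]}).$$ A left Alia algebra is $(A,[,])$ with $[,]$ bilinear and $[[x,y],z]+[[y,z],x]+[[z,x],y]=[[y,x],z]+[[z,y],x]+[[x,z],y]$. A left Alia coalgebra is $(A,\Delta)$ with $$x_{(1)(2)}\otimes x_{(1)(1)}\otimes x_{(2)}+x_{(1)(1)}\otimes x_{(2)}\otimes x_{(1)(2)}+x_{(2)}\otimes x_{(1)(2)}\otimes x_{(1)(1)}=x_{(1)(1)}\otimes x_{(1)(2)}\otimes x_{(2)}+x_{(1)(2)}\otimes x_{(2)}\otimes x_{(1)(1)}+x_{(2)}\otimes x_{(1)(1)}\otimes x_{(1)(2)},$$ where $x_{(1)(1)}\otimes x_{(1)(2)}\otimes x_{(2)}=(\Delta\otimes\mathrm{id})\Delta(x)$. A left Alia bialgebra is $(A,[,],\Delta)$ with $(A,[,])$ a left Alia algebra, $(A,\Delta)$ a left Alia coalgebra and $(\tau-\mathrm{id}^{\otimes 2})(\Delta([x,y]-[y,x]))=(\tau-\mathrm{id}^{\otimes 2})((\mathcal R(y)\otimes\mathrm{id})\Delta(x)-(\mathcal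 R(x)\otimes\mathrm{id})\Delta(y))$, where $\mathcal R(y)z=[z,y]$. A Nijenhuis left Alia bialgebra $((A,[,],\Delta),N,S)$ is a left Alia bialgebra with linear maps $N,S:A\to A$ such that $N$ is a Nijenhuis operator on $(A,[,])$, $S$ is a Nijenhuis operator on $(A,\Delta)$, and for all $x,y\in A$: $S[N(x),y]+[x,S^2(y)]=S[x,S(y)]+[N(x),S(y)]$; $S[x,N(y)]+[S^2(x),y]=S[S(x),y]+[S(x),N(y)]$; $S(N(x)_{(1)})\otimes N(x)_{(2)}+x_{(1)}\otimes N^2(x_{(2)})=S(x_{(1)})\otimes N(x_{(2)})+N(x)_{(1)}\otimes N(N(x)_{(2)})$; $N(x)_{(1)}\otimes S(N(x)_{(2)})+N^2(x_{(1)})\otimes x_{(2)}=N(x_{(1)})\otimes S(x_{(2)})+N(N(x)_{(1)})\otimes N(x)_{(2)}$. *)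

theory Defs
  imports Complex_Main "HOL-Library.Poly_Mapping"
begin

text \<open>
  The library has no tensor product of vector spaces, so \<open>A \<otimes> A\<close> and \<open>A \<otimes> A \<otimes> A\<close> are built as
  quotients: the vector space \<open>'x \<Rightarrow>\<^sub>0 'k\<close> freely generated by all pairs (triples) of elements
  of \<open>A\<close>, modulo the subspace spanned by the relations of multilinearity.  A tensor is a coset
  of that subspace.  The space \<open>A\<close> is a whole type with a scalar multiplication \<open>scale\<close> satisfying
  \<^locale>\<open>vector_space\<close>; it need not be finite-dimensional.
\<close>

definition free_scale :: "'k::field \<Rightarrow> ('x \<Rightarrow>\<^sub>0 'k) \<Rightarrow> ('x \<Rightarrow>\<^sub>0 'k)" where
  "free_scale c = Poly_Mapping.map ((*) c)"

lemma lookup_free_scale [simp]: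
  "Poly_Mapping.lookup (free_scale c u) p = c * Poly_Mapping.lookup u p"
  by (simp add: free_scale_def map.rep_eq when_def)

interpretation free: vector_space "free_scale :: 'k::field \<Rightarrow> ('x \<Rightarrow>\<^sub>0 'k) \<Rightarrow> ('x \<Rightarrow>\<^sub>0 'k)"
  by unfold_locales
    (auto intro!: poly_mapping_eqI simp: lookup_add algebra_simps)

definition coset :: "('x \<Rightarrow>\<^sub>0 'k::field) set \<Rightarrow> ('x \<Rightarrow>\<^sub>0 'k) \<Rightarrow> ('x \<Rightarrow>\<^sub>0 'k) set" where
  "coset R u = {v. v - u \<in> free.span R}"

definition formal_sum :: "'x list \<Rightarrow> ('x \<Rightarrow>\<^sub>0 'k::field)" where
  "formal_sum xs = (\<Sum>p\<leftarrow>xs. Poly_Mapping.single p 1)"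

type_synonym ('k, 'a) tensor2 = "('a \<times> 'a \<Rightarrow>\<^sub>0 'k) set"
type_synonym ('k, 'a) tensor3 = "('a \<times> 'a \<times> 'a \<Rightarrow>\<^sub>0 'k) set"

definition relations2 ::
    "('k::field \<Rightarrow> 'a::ab_group_add \<Rightarrow> 'a) \<Rightarrow> ('a \<times> 'a \<Rightarrow>\<^sub>0 'k) set" where
  "relations2 scale =
     {Poly_Mapping.single (x + x', y) 1 - Poly_Mapping.single (x, y) 1
        - Poly_Mapping.single (x', y) 1 | x x' y. True} \<union>
     {Poly_Mapping.single (x, y + y') 1 - Poly_Mapping.single (x, y) 1
        - Poly_Mapping.single (x, y') 1 | x y y'. True} \<union>
     {Poly_Mapping.single (scale c x, y) 1 - Poly_Mapping.single (x, y) c | c x y. True} \<union>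
     {Poly_Mapping.single (x, scale c y) 1 - Poly_Mapping.single (x, y) c | c x y. True}"

definition relations3 ::
    "('k::field \<Rightarrow> 'a::ab_group_add \<Rightarrow> 'a) \<Rightarrow> ('a \<times> 'a \<times> 'a \<Rightarrow>\<^sub>0 'k) set" where
  "relations3 scale =
     {Poly_Mapping.single (x + x', y, z) 1 - Poly_Mapping.single (x, y, z) 1
        - Poly_Mapping.single (x', y, z) 1 | x x' y z. True} \<union>
     {Poly_Mapping.single (x, y + y', z) 1 - Poly_Mapping.single (x, y, z) 1
        - Poly_Mapping.single (x, y', z) 1 | x y y' z. True} \<union>
     {Poly_Mapping.single (x, y, z + z') 1 - Poly_Mapping.single (x, y, z) 1
        - Poly_Mapping.single (x, y, z') 1 | x y z z'. True} \<union>
     {Poly_Mapping.single (scale c x, y, z) 1 - Poly_Mapping.single (x, y, z) c | c x y z. True} \<union>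
     {Poly_Mapping.single (x, scale c y, z) 1 - Poly_Mapping.single (x, y, z) c | c x y z. True} \<union>
     {Poly_Mapping.single (x, y, scale c z) 1 - Poly_Mapping.single (x, y, z) c | c x y z. True}"

definition tensor_square ::
    "('k::field \<Rightarrow> 'a::ab_group_add \<Rightarrow> 'a) \<Rightarrow> ('k, 'a) tensor2 set" where
  "tensor_square scale = range (coset (relations2 scale))"

text \<open>
  \<open>ten2 scale [(a\<^sub>1, b\<^sub>1), \<dots>, (a\<^sub>n, b\<^sub>n)]\<close> is the tensor \<open>a\<^sub>1 \<otimes> b\<^sub>1 + \<dots> + a\<^sub>n \<otimes> b\<^sub>n\<close>; thus
  concatenation of lists is addition of tensors.  Conversely \<open>sweedler scale T\<close> is some list
  representing \<open>T\<close>.  Sweedler notation is list comprehension: for linear \<open>f\<close> and \<open>g\<close>,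
  \<open>f(x\<^sub>[\<^sub>1\<^sub>]) \<otimes> g(x\<^sub>[\<^sub>2\<^sub>])\<close> is \<open>ten2 scale [(f a, g b). (a, b) \<leftarrow> sweedler scale (\<delta> x)]\<close>.
  By \<open>bilinear_respects_ten2\<close>, applied to the subspace spanned by the relations, the value of such
  an expression does not depend on the list chosen.
\<close>

definition ten2 ::
    "('k::field \<Rightarrow> 'a::ab_group_add \<Rightarrow> 'a) \<Rightarrow> ('a \<times> 'a) list \<Rightarrow> ('k, 'a) tensor2" where
  "ten2 scale xs = coset (relations2 scale) (formal_sum xs)"

definition ten3 ::
    "('k::field \<Rightarrow> 'a::ab_group_add \<Rightarrow> 'a) \<Rightarrow> ('a \<times> 'a \<times> 'a) list \<Rightarrow> ('k, 'a) tensor3" where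
  "ten3 scale xs = coset (relations3 scale) (formal_sum xs)"

definition sweedler ::
    "('k::field \<Rightarrow> 'a::ab_group_add \<Rightarrow> 'a) \<Rightarrow> ('k, 'a) tensor2 \<Rightarrow> ('a \<times> 'a) list" where
  "sweedler scale T = (SOME xs. ten2 scale xs = T)"

lemma coset_eq_iff: "coset R u = coset R v \<longleftrightarrow> u - v \<in> free.span R"
proof
  assume "coset R u = coset R v"
  moreover have "u \<in> coset R u" by (simp add: coset_def free.span_zero)
  ultimately show "u - v \<in> free.span R" by (auto simp: coset_def)
next
  assume h: "u - v \<in> free.span R"
  have "w - u \<in> free.span R \<longleftrightarrow> w - v \<in> free.span R" for w
    using free.span_add[OF _ h, of "w - u"] free.span_diff[OF _ h, of "w - v"] by auto
  then show "coset R u = coset R v" by (simp add: coset_def)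
qed

lemma tensor_square_eq_range_ten2: "tensor_square scale = range (ten2 scale)"
proof -
  have "\<exists>xs. u - formal_sum xs \<in> free.span (relations2 scale)" for u
  proof (induction u rule: update_induct)
    case const
    show ?case by (intro exI[of _ "[]"]) (simp add: formal_sum_def free.span_zero)
  next
    case (update u p c)
    then obtain xs where xs: "u - formal_sum xs \<in> free.span (relations2 scale)" by blast
    obtain a b where p: "p = (a, b)" by (cases p)
    have "Poly_Mapping.single (scale c a, b) 1 - Poly_Mapping.single (a, b) c
            \<in> free.span (relations2 scale)"
      by (rule free.span_base) (auto simp: relations2_def)
    from free.span_diff[OF xs this]
    have "u + Poly_Mapping.single p c - formal_sum ((scale c a, b) # xs)
            \<in> free.span (relations2 scale)"
      by (simp add: p formal_sum_def algebra_simps)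
    moreover have "Poly_Mapping.update p c u = u + Poly_Mapping.single p c"
      using update by (auto intro!: poly_mapping_eqI
          simp: lookup_add lookup_update lookup_single in_keys_iff when_def)
    ultimately show ?case by metis
  qed
  then show ?thesis
    by (auto simp: tensor_square_def ten2_def image_iff coset_eq_iff)
qed

lemma ten2_sweedler: "T \<in> tensor_square scale \<Longrightarrow> ten2 scale (sweedler scale T) = T"
  unfolding sweedler_def tensor_square_eq_range_ten2 by (rule someI_ex) auto

lemma bilinear_respects_ten2:
  fixes h :: "'a::ab_group_add \<Rightarrow> 'a \<Rightarrow> 'b::ab_group_add"
  assumes "vector_space scaleB" and W: "module.subspace scaleB W"
    and add_left: "\<And>x x' y. h (x + x') y - h x y - h x' y \<in> W"
    and add_right: "\<And>x y y'. h x (y + y') - h x y - h x y' \<in> W"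
    and scale_left: "\<And>c x y. h (scale c x) y - scaleB c (h x y) \<in> W"
    and scale_right: "\<And>c x y. h x (scale c y) - scaleB c (h x y) \<in> W"
    and eq: "ten2 scale xs = ten2 scale ys"
  shows "(\<Sum>(a, b)\<leftarrow>xs. h a b) - (\<Sum>(a, b)\<leftarrow>ys. h a b) \<in> W"
proof -
  interpret B: vector_space scaleB by fact
  define E where
    "E u = (\<Sum>p\<in>Poly_Mapping.keys u. scaleB (Poly_Mapping.lookup u p) (h (fst p) (snd p)))" for u
  have E_sup: "E u = (\<Sum>p\<in>P. scaleB (Poly_Mapping.lookup u p) (h (fst p) (snd p)))"
    if "finite P" "Poly_Mapping.keys u \<subseteq> P" for u P
    unfolding E_def using that
    by (intro sum.mono_neutral_left) (auto simp: in_keys_iff)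
  have E_add: "E (u + v) = E u + E v" for u v
    using Poly_Mapping.keys_add[of u v]
    by (simp add: E_sup[of "Poly_Mapping.keys u \<union> Poly_Mapping.keys v"] lookup_add
        B.scale_left_distrib sum.distrib)
  have E_scale: "E (free_scale c u) = scaleB c (E u)" for c u
  proof -
    have "Poly_Mapping.keys (free_scale c u) \<subseteq> Poly_Mapping.keys u"
      by (auto simp: in_keys_iff)
    then show ?thesis
      by (simp add: E_sup[of "Poly_Mapping.keys u"] B.scale_sum_right)
  qed
  have E_diff: "E (u - v) = E u - E v" for u v
    using E_add[of "u - v" v] by simp
  have E_single: "E (Poly_Mapping.single (a, b) c) = scaleB c (h a b)" for a b c
    by (subst E_sup[of "{(a, b)}"]) auto
  have E_sum: "E (formal_sum zs) = (\<Sum>(a, b)\<leftarrow>zs. h a b)" for zs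
  proof (induction zs)
    case Nil
    then show ?case by (simp add: formal_sum_def E_def)
  next
    case (Cons z zs)
    then show ?case by (cases z) (simp add: formal_sum_def E_add E_single)
  qed
  have rel: "E u \<in> W" if "u \<in> relations2 scale" for u
    using that unfolding relations2_def
    by (auto simp: E_diff E_single add_left add_right scale_left scale_right)
  have "formal_sum xs - formal_sum ys \<in> free.span (relations2 scale)"
    using eq by (simp add: ten2_def coset_eq_iff)
  then have "E (formal_sum xs - formal_sum ys) \<in> W"
  proof (induction rule: free.span_induct_alt)
    case base
    then show ?case by (simp add: E_def B.subspace_0[OF W])
  next
    case (step c u v)
    then show ?case
      by (simp add: E_add E_scale rel B.subspace_add[OF W] B.subspace_scale[OF W])
  qed
  then show ?thesis by (simp add: E_diff E_sum)
qed

definition bilinear_op ::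
    "('k::field \<Rightarrow> 'a::ab_group_add \<Rightarrow> 'a) \<Rightarrow> ('a \<Rightarrow> 'a \<Rightarrow> 'a) \<Rightarrow> bool" where
  "bilinear_op scale m \<longleftrightarrow>
     (\<forall>x. Vector_Spaces.linear scale scale (m x)) \<and>
     (\<forall>y. Vector_Spaces.linear scale scale (\<lambda>x. m x y))"

definition comultiplication ::
    "('k::field \<Rightarrow> 'a::ab_group_add \<Rightarrow> 'a) \<Rightarrow> ('a \<Rightarrow> ('k, 'a) tensor2) \<Rightarrow> bool" where
  "comultiplication scale \<Delta> \<longleftrightarrow>
     (\<forall>x. \<Delta> x \<in> tensor_square scale) \<and>
     (\<forall>x y. \<Delta> (x + y) = ten2 scale (sweedler scale (\<Delta> x) @ sweedler scale (\<Delta> y))) \<and>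
     (\<forall>c x. \<Delta> (scale c x) = ten2 scale [(scale c a, b). (a, b) \<leftarrow> sweedler scale (\<Delta> x)])"

definition nijenhuis_operator ::
    "('k::field \<Rightarrow> 'a::ab_group_add \<Rightarrow> 'a) \<Rightarrow> ('a \<Rightarrow> 'a \<Rightarrow> 'a) \<Rightarrow> ('a \<Rightarrow> 'a) \<Rightarrow> bool" where
  "nijenhuis_operator scale m N \<longleftrightarrow>
     Vector_Spaces.linear scale scale N \<and>
     (\<forall>x y. m (N x) (N y) + N (N (m x y)) = N (m (N x) y + m x (N y)))"

definition nijenhuis_cooperator ::
    "('k::field \<Rightarrow> 'a::ab_group_add \<Rightarrow> 'a) \<Rightarrow> ('a \<Rightarrow> ('k, 'a) tensor2) \<Rightarrow> ('a \<Rightarrow> 'a) \<Rightarrow> bool" where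
  "nijenhuis_cooperator scale \<Delta> S \<longleftrightarrow>
     Vector_Spaces.linear scale scale S \<and>
     (\<forall>x. ten2 scale ([(S a, S b). (a, b) \<leftarrow> sweedler scale (\<Delta> x)]
                      @ sweedler scale (\<Delta> (S (S x))))
        = ten2 scale ([(S a, b). (a, b) \<leftarrow> sweedler scale (\<Delta> (S x))]
                      @ [(a, S b). (a, b) \<leftarrow> sweedler scale (\<Delta> (S x))]))"

text \<open>Commutative and cocommutative.\<close>

locale comm_assoc_D_bialgebra = vector_space scale
  for scale :: "'k::field \<Rightarrow> 'a::ab_group_add \<Rightarrow> 'a" +
  fixes mul :: "'a \<Rightarrow> 'a \<Rightarrow> 'a"
    and \<delta> :: "'a \<Rightarrow> ('k, 'a) tensor2"
  assumes bilinear_mul: "bilinear_op scale mul"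
    and mul_assoc: "mul (mul x y) z = mul x (mul y z)"
    and mul_commute: "mul x y = mul y x"
    and comultiplication: "comultiplication scale \<delta>"
    and coassoc:
      "ten3 scale [(a1, a2, b). (a, b) \<leftarrow> sweedler scale (\<delta> x), (a1, a2) \<leftarrow> sweedler scale (\<delta> a)]
       = ten3 scale [(a, b1, b2). (a, b) \<leftarrow> sweedler scale (\<delta> x), (b1, b2) \<leftarrow> sweedler scale (\<delta> b)]"
    and cocommute: "ten2 scale [(b, a). (a, b) \<leftarrow> sweedler scale (\<delta> x)] = \<delta> x"
    and compatible:
      "\<delta> (mul x y) = ten2 scale ([(mul a y, b). (a, b) \<leftarrow> sweedler scale (\<delta> x)]
                                 @ [(a, mul x b). (a, b) \<leftarrow> sweedler scale (\<delta> y)])"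

locale nijenhuis_comm_assoc_D_bialgebra = comm_assoc_D_bialgebra scale mul \<delta>
  for scale :: "'k::field \<Rightarrow> 'a::ab_group_add \<Rightarrow> 'a"
    and mul :: "'a \<Rightarrow> 'a \<Rightarrow> 'a"
    and \<delta> :: "'a \<Rightarrow> ('k, 'a) tensor2" +
  fixes N S :: "'a \<Rightarrow> 'a"
  assumes nijenhuis_N: "nijenhuis_operator scale mul N"
    and nijenhuis_S: "nijenhuis_cooperator scale \<delta> S"
    and adjoint_mul: "S (mul (N x) y) + mul x (S (S y)) = mul (N x) (S y) + S (mul x (S y))"
    and adjoint_comul:
      "ten2 scale ([(S a, b). (a, b) \<leftarrow> sweedler scale (\<delta> (N x))]
                   @ [(a, N (N b)). (a, b) \<leftarrow> sweedler scale (\<delta> x)])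
       = ten2 scale ([(S a, N b). (a, b) \<leftarrow> sweedler scale (\<delta> x)]
                   @ [(a, N b). (a, b) \<leftarrow> sweedler scale (\<delta> (N x))])"

locale left_alia_algebra = vector_space scale
  for scale :: "'k::field \<Rightarrow> 'a::ab_group_add \<Rightarrow> 'a" +
  fixes br :: "'a \<Rightarrow> 'a \<Rightarrow> 'a"
  assumes bilinear_br: "bilinear_op scale br"
    and left_alia:
      "br (br x y) z + br (br y z) x + br (br z x) y
       = br (br y x) z + br (br z y) x + br (br x z) y"

text \<open>Below, \<open>(a, b, c)\<close> runs over \<open>x\<^sub>(\<^sub>1\<^sub>)\<^sub>(\<^sub>1\<^sub>) \<otimes> x\<^sub>(\<^sub>1\<^sub>)\<^sub>(\<^sub>2\<^sub>) \<otimes> x\<^sub>(\<^sub>2\<^sub>)\<close>.\<close>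

locale left_alia_coalgebra = vector_space scale
  for scale :: "'k::field \<Rightarrow> 'a::ab_group_add \<Rightarrow> 'a" +
  fixes \<Delta> :: "'a \<Rightarrow> ('k, 'a) tensor2"
  assumes comultiplication: "comultiplication scale \<Delta>"
    and left_coalia:
      "ten3 scale
         ([(b, a, c). (p, c) \<leftarrow> sweedler scale (\<Delta> x), (a, b) \<leftarrow> sweedler scale (\<Delta> p)]
        @ [(a, c, b). (p, c) \<leftarrow> sweedler scale (\<Delta> x), (a, b) \<leftarrow> sweedler scale (\<Delta> p)]
        @ [(c, b, a). (p, c) \<leftarrow> sweedler scale (\<Delta> x), (a, b) \<leftarrow> sweedler scale (\<Delta> p)])
       = ten3 scale
         ([(a, b, c). (p, c) \<leftarrow> sweedler scale (\<Delta> x), (a, b) \<leftarrow> sweedler scale (\<Delta> p)]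
        @ [(b, c, a). (p, c) \<leftarrow> sweedler scale (\<Delta> x), (a, b) \<leftarrow> sweedler scale (\<Delta> p)]
        @ [(c, a, b). (p, c) \<leftarrow> sweedler scale (\<Delta> x), (a, b) \<leftarrow> sweedler scale (\<Delta> p)])"

definition flip_minus_id ::
    "('k::field \<Rightarrow> 'a::ab_group_add \<Rightarrow> 'a) \<Rightarrow> ('k, 'a) tensor2 \<Rightarrow> ('k, 'a) tensor2" where
  "flip_minus_id scale T = ten2 scale ([(b, a). (a, b) \<leftarrow> sweedler scale T]
                                       @ [(- a, b). (a, b) \<leftarrow> sweedler scale T])"

locale left_alia_bialgebra = left_alia_algebra scale br + left_alia_coalgebra scale \<Delta>
  for scale :: "'k::field \<Rightarrow> 'a::ab_group_add \<Rightarrow> 'a"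
    and br :: "'a \<Rightarrow> 'a \<Rightarrow> 'a"
    and \<Delta> :: "'a \<Rightarrow> ('k, 'a) tensor2" +
  assumes compatible:
      "flip_minus_id scale (\<Delta> (br x y - br y x))
       = flip_minus_id scale (ten2 scale ([(br a y, b). (a, b) \<leftarrow> sweedler scale (\<Delta> x)]
                                          @ [(- br a x, b). (a, b) \<leftarrow> sweedler scale (\<Delta> y)]))"

locale nijenhuis_left_alia_bialgebra = left_alia_bialgebra scale br \<Delta>
  for scale :: "'k::field \<Rightarrow> 'a::ab_group_add \<Rightarrow> 'a"
    and br :: "'a \<Rightarrow> 'a \<Rightarrow> 'a"
    and \<Delta> :: "'a \<Rightarrow> ('k, 'a) tensor2" +
  fixes N S :: "'a \<Rightarrow> 'a"
  assumes nijenhuis_N: "nijenhuis_operator scale br N"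
    and nijenhuis_S: "nijenhuis_cooperator scale \<Delta> S"
    and adjoint_br_left:
      "S (br (N x) y) + br x (S (S y)) = S (br x (S y)) + br (N x) (S y)"
    and adjoint_br_right:
      "S (br x (N y)) + br (S (S x)) y = S (br (S x) y) + br (S x) (N y)"
    and adjoint_comul_left:
      "ten2 scale ([(S a, b). (a, b) \<leftarrow> sweedler scale (\<Delta> (N x))]
                   @ [(a, N (N b)). (a, b) \<leftarrow> sweedler scale (\<Delta> x)])
       = ten2 scale ([(S a, N b). (a, b) \<leftarrow> sweedler scale (\<Delta> x)]
                   @ [(a, N b). (a, b) \<leftarrow> sweedler scale (\<Delta> (N x))])"
    and adjoint_comul_right:
      "ten2 scale ([(a, S b). (a, b) \<leftarrow> sweedler scale (\<Delta> (N x))]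
                   @ [(N (N a), b). (a, b) \<leftarrow> sweedler scale (\<Delta> x)])
       = ten2 scale ([(N a, S b). (a, b) \<leftarrow> sweedler scale (\<Delta> x)]
                   @ [(N a, b). (a, b) \<leftarrow> sweedler scale (\<Delta> (N x))])"

definition special_bracket ::
    "('a::ab_group_add \<Rightarrow> 'a \<Rightarrow> 'a) \<Rightarrow> ('a \<Rightarrow> 'a) \<Rightarrow> ('a \<Rightarrow> 'a) \<Rightarrow> 'a \<Rightarrow> 'a \<Rightarrow> 'a" where
  "special_bracket mul f g x y = mul x (f y) + g (mul x y)"

definition special_comul ::
    "('k::field \<Rightarrow> 'a::ab_group_add \<Rightarrow> 'a) \<Rightarrow> ('a \<Rightarrow> ('k, 'a) tensor2) \<Rightarrow>
     ('a \<Rightarrow> 'a) \<Rightarrow> ('a \<Rightarrow> 'a) \<Rightarrow> 'a \<Rightarrow> ('k, 'a) tensor2" where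
  "special_comul scale \<delta> g f x = ten2 scale ([(a, g b). (a, b) \<leftarrow> sweedler scale (\<delta> x)]
                                             @ sweedler scale (\<delta> (f x)))"

end

theory Submission
  imports Defs
begin

text \<open>
  Every axiom about a comultiplication is an equation between tensors in \<open>A \<otimes> A\<close> or
  \<open>A \<otimes> A \<otimes> A\<close>.  Over a field, two tensors are equal as soon as all bilinear (trilinear) forms
  take the same value on them (\<open>ten2_eq_iff\<close>, \<open>ten3_eq_iff\<close>).  So a comultiplication \<open>\<delta>\<close> is
  replaced by its contractions \<open>\<beta>(x\<^sub>[\<^sub>1\<^sub>], x\<^sub>[\<^sub>2\<^sub>])\<close>, which are scalars, linear in \<open>x\<close>, and each axiom
  becomes an identity between scalars.  In particular, contracting the new comultiplication gives
  \<open>\<beta>(x\<^sub>[\<^sub>1\<^sub>], S(x\<^sub>[\<^sub>2\<^sub>])) + \<beta>(N(x)\<^sub>[\<^sub>1\<^sub>], N(x)\<^sub>[\<^sub>2\<^sub>])\<close> (\<open>contract_special\<close>); here \<open>N = f\<close> and \<open>S = g\<close>.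

  The left Alia identity says that the alternating sum of \<open>[[x, y], z]\<close> over all permutations of
  \<open>x, y, z\<close> vanishes.  Expanding \<open>[[x, y], z]\<close> gives four terms, and by commutativity and
  associativity each of them is invariant under some transposition of \<open>x, y, z\<close>; the alternating sum
  is therefore zero.  The coalgebra identity is dual: \<open>(\<Delta> \<otimes> id)\<Delta>(x)\<close> is a sum of four tensors, each fixed by a transposition of its
  factors (\<open>contract2_swap\<close>, \<open>contract2_N_swap\<close>).

  For the compatibility of bracket and comultiplication, \<open>\<tau> - id\<close> kills symmetric tensors, so the
  summand \<open>\<delta>(N(w))\<close> of \<open>\<Delta>(w)\<close> disappears.  The terms left over on the other side are killed too,
  because \<open>x\<^sub>[\<^sub>1\<^sub>]\<cdot>y \<otimes> x\<^sub>[\<^sub>2\<^sub>] - y\<^sub>[\<^sub>1\<^sub>]\<cdot>x \<otimes> y\<^sub>[\<^sub>2\<^sub>]\<close> is symmetric: modulo symmetric tensors a flip is a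
  change of sign, so this tensor agrees with the symmetric tensor
  \<open>\<delta>(x\<cdot>y) = x\<^sub>[\<^sub>1\<^sub>]\<cdot>y \<otimes> x\<^sub>[\<^sub>2\<^sub>] + y\<^sub>[\<^sub>1\<^sub>] \<otimes> x\<cdot>y\<^sub>[\<^sub>2\<^sub>]\<close> (\<open>contract_mul_swap\<close>).

  Each of the six Nijenhuis and adjointness conditions for the bracket and \<open>\<Delta>\<close> is a sum of two
  instances of the corresponding condition for \<open>\<cdot>\<close> or \<open>\<delta>\<close>.  In one instance \<open>N\<close> is applied to an
  argument; in the other \<open>S\<close> is applied to the whole equation (to its second tensor factor, for
  \<open>\<delta>\<close>).  The hypothesis \<open>N \<circ> S = S \<circ> N\<close> identifies terms such as \<open>N(S(x\<cdot>y))\<close> and \<open>S(N(x\<cdot>y))\<close>.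
\<close>

section \<open>Multilinear forms separate tensors\<close>

definition bilinear_form ::
    "('k::field \<Rightarrow> 'a::ab_group_add \<Rightarrow> 'a) \<Rightarrow> ('a \<Rightarrow> 'a \<Rightarrow> 'k) \<Rightarrow> bool" where
  "bilinear_form scale \<beta> \<longleftrightarrow>
     (\<forall>x x' y. \<beta> (x + x') y = \<beta> x y + \<beta> x' y) \<and>
     (\<forall>x y y'. \<beta> x (y + y') = \<beta> x y + \<beta> x y') \<and>
     (\<forall>c x y. \<beta> (scale c x) y = c * \<beta> x y) \<and>
     (\<forall>c x y. \<beta> x (scale c y) = c * \<beta> x y)"

definition trilinear_form ::
    "('k::field \<Rightarrow> 'a::ab_group_add \<Rightarrow> 'a) \<Rightarrow> ('a \<Rightarrow> 'a \<Rightarrow> 'a \<Rightarrow> 'k) \<Rightarrow> bool" where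
  "trilinear_form scale \<gamma> \<longleftrightarrow>
     (\<forall>x x' y z. \<gamma> (x + x') y z = \<gamma> x y z + \<gamma> x' y z) \<and>
     (\<forall>x y y' z. \<gamma> x (y + y') z = \<gamma> x y z + \<gamma> x y' z) \<and>
     (\<forall>x y z z'. \<gamma> x y (z + z') = \<gamma> x y z + \<gamma> x y z') \<and>
     (\<forall>c x y z. \<gamma> (scale c x) y z = c * \<gamma> x y z) \<and>
     (\<forall>c x y z. \<gamma> x (scale c y) z = c * \<gamma> x y z) \<and>
     (\<forall>c x y z. \<gamma> x y (scale c z) = c * \<gamma> x y z)"

lemma bilinear_form_slices:
  assumes "trilinear_form scale \<gamma>"
  shows "bilinear_form scale (\<lambda>a b. \<gamma> a b c)" "bilinear_form scale (\<lambda>b c. \<gamma> a b c)"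
  using assms by (simp_all add: trilinear_form_def bilinear_form_def)

text \<open>The linear functional on the free vector space with prescribed values on the basis.\<close>

definition extend_free :: "('x \<Rightarrow> 'k) \<Rightarrow> ('x \<Rightarrow>\<^sub>0 'k::field) \<Rightarrow> 'k" where
  "extend_free h u = (\<Sum>p\<in>Poly_Mapping.keys u. Poly_Mapping.lookup u p * h p)"

lemma extend_free_superset:
  assumes "finite P" "Poly_Mapping.keys u \<subseteq> P"
  shows "extend_free h u = (\<Sum>p\<in>P. Poly_Mapping.lookup u p * h p)"
  unfolding extend_free_def using assms
  by (intro sum.mono_neutral_left) (auto simp: in_keys_iff)

lemma extend_free_add: "extend_free h (u + v) = extend_free h u + extend_free h v"
  using Poly_Mapping.keys_add[of u v]
  by (simp add: extend_free_superset[of "Poly_Mapping.keys u \<union> Poly_Mapping.keys v"] lookup_add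
      distrib_right sum.distrib)

lemma extend_free_scale: "extend_free h (free_scale c u) = c * extend_free h u"
proof -
  have "Poly_Mapping.keys (free_scale c u) \<subseteq> Poly_Mapping.keys u"
    by (auto simp: in_keys_iff)
  then show ?thesis
    by (simp add: extend_free_superset[of "Poly_Mapping.keys u"] sum_distrib_left mult.assoc)
qed

lemma extend_free_diff: "extend_free h (u - v) = extend_free h u - extend_free h v"
  using extend_free_add[of h "u - v" v] by simp

lemma extend_free_single: "extend_free h (Poly_Mapping.single p c) = c * h p"
  by (subst extend_free_superset[of "{p}"]) auto

lemma extend_free_formal_sum: "extend_free h (formal_sum xs) = (\<Sum>p\<leftarrow>xs. h p)"
proof (induction xs)
  case Nil
  then show ?case by (simp add: formal_sum_def extend_free_def)
next
  case (Cons z zs)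
  then show ?case by (simp add: formal_sum_def extend_free_add extend_free_single)
qed

lemma extend_free_unique:
  assumes "Vector_Spaces.linear free_scale (*) \<phi>"
  shows "\<phi> u = extend_free (\<lambda>p. \<phi> (Poly_Mapping.single p 1)) u"
proof (induction u rule: update_induct)
  interpret Vector_Spaces.linear free_scale "(*)" \<phi> by fact
  case const
  show ?case using zero by (simp add: extend_free_def)
next
  interpret Vector_Spaces.linear free_scale "(*)" \<phi> by fact
  case (update u p c)
  have eq: "Poly_Mapping.update p c u = u + free_scale c (Poly_Mapping.single p 1)"
    using update by (auto intro!: poly_mapping_eqI
        simp: lookup_add lookup_update lookup_single in_keys_iff when_def)
  show ?case unfolding eq add scale extend_free_add extend_free_scale extend_free_single
    using update by simp
qed

text \<open>
  If the difference of the two formal sums lies outside the span of \<open>R\<close>, it extends a basis of that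
  span to an independent set, so some functional vanishes on \<open>R\<close> but not on the difference.
\<close>

lemma coset_formal_sum_eq_iff:
  fixes R :: "('x \<Rightarrow>\<^sub>0 'k::field) set"
  shows "coset R (formal_sum xs) = coset R (formal_sum ys) \<longleftrightarrow>
     (\<forall>h :: 'x \<Rightarrow> 'k. (\<forall>r\<in>R. extend_free h r = 0) \<longrightarrow> (\<Sum>p\<leftarrow>xs. h p) = (\<Sum>p\<leftarrow>ys. h p))"
  (is "?L \<longleftrightarrow> ?R")
proof
  assume ?L
  then have mem: "formal_sum xs - formal_sum ys \<in> free.span R" by (simp add: coset_eq_iff)
  show ?R
  proof (intro allI impI)
    fix h :: "'x \<Rightarrow> 'k" assume R: "\<forall>r\<in>R. extend_free h r = 0"
    from mem have "extend_free h (formal_sum xs - formal_sum ys) = 0"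
      by (induction rule: free.span_induct_alt)
        (auto simp: R extend_free_add extend_free_scale, simp add: extend_free_def)
    then show "(\<Sum>p\<leftarrow>xs. h p) = (\<Sum>p\<leftarrow>ys. h p)"
      by (simp add: extend_free_diff extend_free_formal_sum)
  qed
next
  assume R: ?R
  show ?L
  proof (rule ccontr)
    define u :: "'x \<Rightarrow>\<^sub>0 'k" where "u = formal_sum xs - formal_sum ys"
    assume "\<not> ?L"
    then have u: "u \<notin> free.span R" by (simp add: coset_eq_iff u_def)
    interpret K: vector_space "(*) :: 'k \<Rightarrow> 'k \<Rightarrow> 'k"
      by unfold_locales (auto simp: algebra_simps)
    interpret vector_space_pair "free_scale :: 'k \<Rightarrow> ('x \<Rightarrow>\<^sub>0 'k) \<Rightarrow> _" "(*) :: 'k \<Rightarrow> 'k \<Rightarrow> 'k" ..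
    obtain B where B: "B \<subseteq> R" "free.independent B" "R \<subseteq> free.span B"
      using free.maximal_independent_subset by metis
    then have "free.span B = free.span R"
      by (meson free.span_minimal free.span_mono free.subspace_span subset_antisym)
    with u B(2) have "free.independent (insert u B)" "u \<notin> B"
      by (auto simp: free.independent_insert free.span_base)
    from linear_independent_extend[OF this(1), of "\<lambda>b. if b = u then 1 else 0"] \<open>u \<notin> B\<close>
    obtain \<phi> where \<phi>: "Vector_Spaces.linear free_scale (*) \<phi>" "\<phi> u = 1" "\<forall>b\<in>B. \<phi> b = 0"
      by fastforce
    define h where "h = (\<lambda>p. \<phi> (Poly_Mapping.single p 1))"
    have ext: "\<phi> v = extend_free h v" for v
      unfolding h_def by (rule extend_free_unique[OF \<phi>(1)])
    have "\<phi> r = 0" if "r \<in> free.span B" for r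
      using that by (induction rule: free.span_induct_alt)
        (use \<phi>(3) in \<open>auto simp: ext extend_free_add extend_free_scale\<close>, simp add: extend_free_def)
    with B(3) have "\<forall>r\<in>R. extend_free h r = 0" by (auto simp flip: ext)
    with R have "(\<Sum>p\<leftarrow>xs. h p) = (\<Sum>p\<leftarrow>ys. h p)" by blast
    then have "\<phi> u = 0" by (simp add: u_def ext extend_free_diff extend_free_formal_sum)
    with \<phi>(2) show False by simp
  qed
qed

text \<open>The generating relations are exactly the four clauses of bilinearity, one by one.\<close>

lemma kills_relations2_iff:
  "(\<forall>r\<in>relations2 scale. extend_free h r = 0) \<longleftrightarrow> bilinear_form scale (\<lambda>a b. h (a, b))"
proof -
  have ball3: "(\<forall>r\<in>{F x y z | x y z. True}. P r) \<longleftrightarrow> (\<forall>x y z. P (F x y z))"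
    for F :: "'c \<Rightarrow> 'd \<Rightarrow> 'e \<Rightarrow> 'f" and P
    by blast
  show ?thesis
    unfolding relations2_def bilinear_form_def ball_Un ball3
    by (simp add: extend_free_diff extend_free_add extend_free_single diff_diff_add)
qed

lemma kills_relations3_iff:
  "(\<forall>r\<in>relations3 scale. extend_free h r = 0) \<longleftrightarrow> trilinear_form scale (\<lambda>a b c. h (a, b, c))"
proof -
  have ball4: "(\<forall>r\<in>{F w x y z | w x y z. True}. P r) \<longleftrightarrow> (\<forall>w x y z. P (F w x y z))"
    for F :: "'c \<Rightarrow> 'd \<Rightarrow> 'e \<Rightarrow> 'f \<Rightarrow> 'g" and P
    by blast
  show ?thesis
    unfolding relations3_def trilinear_form_def ball_Un ball4
    by (simp add: extend_free_diff extend_free_add extend_free_single diff_diff_add)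
qed

lemma ten2_eq_iff:
  fixes scale :: "'k::field \<Rightarrow> 'a::ab_group_add \<Rightarrow> 'a"
  shows "ten2 scale xs = ten2 scale ys \<longleftrightarrow>
     (\<forall>\<beta>. bilinear_form scale \<beta> \<longrightarrow> (\<Sum>(a, b)\<leftarrow>xs. \<beta> a b) = (\<Sum>(a, b)\<leftarrow>ys. \<beta> a b))"
proof -
  have all_curry: "(\<forall>h. P h) \<longleftrightarrow> (\<forall>\<beta>. P (\<lambda>(a, b). \<beta> a b))" for P :: "('a \<times> 'a \<Rightarrow> 'k) \<Rightarrow> bool"
  proof
    assume "\<forall>\<beta>. P (\<lambda>(a, b). \<beta> a b)"
    then have "P (\<lambda>(a, b). h (a, b))" for h by blast
    then show "\<forall>h. P h" by simp
  qed blast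
  show ?thesis
    unfolding ten2_def coset_formal_sum_eq_iff kills_relations2_iff
    by (subst all_curry) simp
qed

lemma ten3_eq_iff:
  fixes scale :: "'k::field \<Rightarrow> 'a::ab_group_add \<Rightarrow> 'a"
  shows "ten3 scale xs = ten3 scale ys \<longleftrightarrow>
     (\<forall>\<gamma>. trilinear_form scale \<gamma> \<longrightarrow> (\<Sum>(a, b, c)\<leftarrow>xs. \<gamma> a b c) = (\<Sum>(a, b, c)\<leftarrow>ys. \<gamma> a b c))"
proof -
  have all_curry: "(\<forall>h. P h) \<longleftrightarrow> (\<forall>\<gamma>. P (\<lambda>(a, b, c). \<gamma> a b c))"
    for P :: "('a \<times> 'a \<times> 'a \<Rightarrow> 'k) \<Rightarrow> bool"
  proof
    assume all: "\<forall>\<gamma>. P (\<lambda>(a, b, c). \<gamma> a b c)"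
    show "\<forall>h. P h"
      using all[rule_format, of "\<lambda>a b c. h (a, b, c)" for h] by simp
  qed blast
  show ?thesis
    unfolding ten3_def coset_formal_sum_eq_iff kills_relations3_iff
    by (subst all_curry) simp
qed

section \<open>Contracting a comultiplication with a bilinear form\<close>

definition contract ::
    "('k::field \<Rightarrow> 'a::ab_group_add \<Rightarrow> 'a) \<Rightarrow> ('a \<Rightarrow> ('k, 'a) tensor2) \<Rightarrow>
     ('a \<Rightarrow> 'a \<Rightarrow> 'k) \<Rightarrow> 'a \<Rightarrow> 'k" where
  "contract scale \<Delta> \<beta> x = (\<Sum>(a, b)\<leftarrow>sweedler scale (\<Delta> x). \<beta> a b)"

lemma sum_list_map_prod:
  "(\<Sum>p\<leftarrow>[F a b. (a, b) \<leftarrow> xs]. h p) = (\<Sum>(a, b)\<leftarrow>xs. h (F a b))"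
  by (simp add: comp_def case_prod_unfold)

lemma sum_list_nested:
  "(\<Sum>p\<leftarrow>[F a b c d. (a, b) \<leftarrow> xs, (c, d) \<leftarrow> G a b]. h p)
   = (\<Sum>(a, b)\<leftarrow>xs. \<Sum>(c, d)\<leftarrow>G a b. h (F a b c d))"
  by (induction xs) (auto simp: comp_def case_prod_unfold)

lemma sum_list_sweedler_ten2:
  assumes "bilinear_form scale \<beta>"
  shows "(\<Sum>(a, b)\<leftarrow>sweedler scale (ten2 scale xs). \<beta> a b) = (\<Sum>(a, b)\<leftarrow>xs. \<beta> a b)"
proof -
  have "ten2 scale (sweedler scale (ten2 scale xs)) = ten2 scale xs"
    by (rule ten2_sweedler) (simp add: tensor_square_eq_range_ten2)
  with assms show ?thesis by (simp add: ten2_eq_iff)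
qed

text \<open>
  The two tensor equations that define linearity of \<open>\<Delta>\<close> are tested on forms; what is left is
  linearity of all contractions.
\<close>

lemma comultiplication_iff_contract:
  "comultiplication scale \<Delta> \<longleftrightarrow>
    (\<forall>x. \<Delta> x \<in> tensor_square scale) \<and>
    (\<forall>\<beta>. bilinear_form scale \<beta> \<longrightarrow>
       (\<forall>x y. contract scale \<Delta> \<beta> (x + y) = contract scale \<Delta> \<beta> x + contract scale \<Delta> \<beta> y) \<and>
       (\<forall>c x. contract scale \<Delta> \<beta> (scale c x) = c * contract scale \<Delta> \<beta> x))"
proof (cases "\<forall>x. \<Delta> x \<in> tensor_square scale")
  case True
  have eq: "\<Delta> x = ten2 scale xs \<longleftrightarrow>
      (\<forall>\<beta>. bilinear_form scale \<beta> \<longrightarrow> contract scale \<Delta> \<beta> x = (\<Sum>(a, b)\<leftarrow>xs. \<beta> a b))" for x xs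
    using True ten2_sweedler[of "\<Delta> x" scale] ten2_eq_iff[of scale "sweedler scale (\<Delta> x)" xs]
    by (simp add: contract_def)
  have "(\<Sum>(a, b)\<leftarrow>[(scale c a, b). (a, b) \<leftarrow> xs]. \<beta> a b) = c * (\<Sum>(a, b)\<leftarrow>xs. \<beta> a b)"
    if "bilinear_form scale \<beta>" for c \<beta> xs
    using that
    by (simp add: bilinear_form_def case_prod_unfold comp_def sum_list_const_mult)
  then have scl: "(\<forall>c x. \<Delta> (scale c x) = ten2 scale [(scale c a, b). (a, b) \<leftarrow> sweedler scale (\<Delta> x)]) \<longleftrightarrow>
      (\<forall>\<beta>. bilinear_form scale \<beta> \<longrightarrow>
        (\<forall>c x. contract scale \<Delta> \<beta> (scale c x) = c * contract scale \<Delta> \<beta> x))"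
    unfolding eq by (auto simp: contract_def)
  have add: "(\<forall>x y. \<Delta> (x + y) = ten2 scale (sweedler scale (\<Delta> x) @ sweedler scale (\<Delta> y))) \<longleftrightarrow>
      (\<forall>\<beta>. bilinear_form scale \<beta> \<longrightarrow>
        (\<forall>x y. contract scale \<Delta> \<beta> (x + y) = contract scale \<Delta> \<beta> x + contract scale \<Delta> \<beta> y))"
    unfolding eq by (auto simp: contract_def)
  show ?thesis
    unfolding comultiplication_def add scl using True by blast
qed (auto simp: comultiplication_def)

lemma contract_plus_form:
  "contract scale \<Delta> (\<lambda>a b. \<beta> a b + \<gamma> a b) x = contract scale \<Delta> \<beta> x + contract scale \<Delta> \<gamma> x"
  by (simp add: contract_def case_prod_unfold sum_list_addf)

lemma contract_scale_form:
  "contract scale \<Delta> (\<lambda>a b. c * \<beta> a b) x = c * contract scale \<Delta> \<beta> x"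
  by (simp add: contract_def case_prod_unfold sum_list_const_mult)

text \<open>
  Evaluating \<open>\<beta>\<close> on \<open>(\<tau> - id)(T)\<close> means evaluating the antisymmetrization of \<open>\<beta>\<close> on \<open>T\<close>.
\<close>

lemma (in vector_space) flip_minus_id_ten2_eq_iff:
  "flip_minus_id scale (ten2 scale xs) = flip_minus_id scale (ten2 scale ys) \<longleftrightarrow>
   (\<forall>\<beta>. bilinear_form scale \<beta> \<longrightarrow>
      (\<Sum>(a, b)\<leftarrow>xs. \<beta> b a - \<beta> a b) = (\<Sum>(a, b)\<leftarrow>ys. \<beta> b a - \<beta> a b))"
proof -
  have "(\<Sum>(a, b)\<leftarrow>sweedler scale T. \<beta> b a) + (\<Sum>(a, b)\<leftarrow>sweedler scale T. \<beta> (- a) b)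
      = (\<Sum>(a, b)\<leftarrow>zs. \<beta> b a - \<beta> a b)" if T: "T = ten2 scale zs" and \<beta>: "bilinear_form scale \<beta>" for T zs \<beta>
  proof -
    have minus: "\<beta> (- a) b = - \<beta> a b" for a b
      using \<beta> scale_minus_left[of 1 a] unfolding bilinear_form_def by (metis mult_minus1 scale_minus_left scale_one)
    have "(\<Sum>(a, b)\<leftarrow>sweedler scale T. \<beta> b a) + (\<Sum>(a, b)\<leftarrow>sweedler scale T. \<beta> (- a) b)
        = (\<Sum>(a, b)\<leftarrow>sweedler scale T. \<beta> b a - \<beta> a b)"
      by (simp add: minus case_prod_unfold flip: sum_list_addf)
    moreover have "bilinear_form scale (\<lambda>a b. \<beta> b a - \<beta> a b)"
      using \<beta> by (simp add: bilinear_form_def algebra_simps)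
    ultimately show ?thesis
      unfolding T by (simp add: sum_list_sweedler_ten2)
  qed
  then show ?thesis
    unfolding flip_minus_id_def ten2_eq_iff map_append sum_list_append sum_list_map_prod prod.case
    by simp
qed

section \<open>The two bialgebra structures seen through contractions\<close>

context comm_assoc_D_bialgebra
begin

abbreviation D where "D \<equiv> contract scale \<delta>"

lemma mul_linearity:
  "mul (x + x') y = mul x y + mul x' y" "mul x (y + y') = mul x y + mul x y'"
  "mul (scale c x) y = scale c (mul x y)" "mul x (scale c y) = scale c (mul x y)"
  using bilinear_mul by (simp_all add: bilinear_op_def Vector_Spaces.linear_iff)

lemma delta_eq_iff:
  "\<delta> x = ten2 scale xs \<longleftrightarrow> (\<forall>\<beta>. bilinear_form scale \<beta> \<longrightarrow> D \<beta> x = (\<Sum>(a, b)\<leftarrow>xs. \<beta> a b))"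
proof -
  have "\<delta> x = ten2 scale (sweedler scale (\<delta> x))"
    using comultiplication by (simp add: comultiplication_def ten2_sweedler)
  then have "\<delta> x = ten2 scale xs \<longleftrightarrow> ten2 scale (sweedler scale (\<delta> x)) = ten2 scale xs" by simp
  then show ?thesis by (simp only: ten2_eq_iff contract_def)
qed

lemma contract_additive:
  "bilinear_form scale \<beta> \<Longrightarrow> D \<beta> (x + y) = D \<beta> x + D \<beta> y"
  "bilinear_form scale \<beta> \<Longrightarrow> D \<beta> (scale c x) = c * D \<beta> x"
  using comultiplication by (simp_all add: comultiplication_iff_contract)

lemma contract_flip:
  assumes "bilinear_form scale \<beta>"
  shows "D (\<lambda>a b. \<beta> b a) x = D \<beta> x"
  using cocommute[of x, symmetric] assms
  unfolding delta_eq_iff sum_list_map_prod prod.case contract_def by simp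

lemma contract_mul:
  assumes "bilinear_form scale \<beta>"
  shows "D \<beta> (mul x y) = D (\<lambda>a b. \<beta> (mul a y) b) x + D (\<lambda>a b. \<beta> a (mul x b)) y"
  using compatible[of x y] assms
  unfolding delta_eq_iff map_append sum_list_append sum_list_map_prod prod.case
  by (simp add: contract_def)

lemma contract_coassoc:
  assumes "trilinear_form scale \<gamma>"
  shows "D (\<lambda>p c. D (\<lambda>a b. \<gamma> a b c) p) x = D (\<lambda>a q. D (\<lambda>b c. \<gamma> a b c) q) x"
  using coassoc[of x] assms
  unfolding ten3_eq_iff sum_list_nested prod.case contract_def by simp

lemma bilinear_form_contract_slices:
  assumes "trilinear_form scale \<gamma>"
  shows "bilinear_form scale (\<lambda>p c. D (\<lambda>a b. \<gamma> a b c) p)"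
proof -
  have "D (\<lambda>a b. \<gamma> a b (c + c')) p = D (\<lambda>a b. \<gamma> a b c) p + D (\<lambda>a b. \<gamma> a b c') p"
    "D (\<lambda>a b. \<gamma> a b (scale k c)) p = k * D (\<lambda>a b. \<gamma> a b c) p" for p c c' k
    using assms by (simp_all add: trilinear_form_def contract_plus_form contract_scale_form)
  then show ?thesis
    unfolding bilinear_form_def
    using contract_additive[OF bilinear_form_slices(1)[OF assms]] by simp
qed

text \<open>The contraction of \<open>\<gamma>\<close> with \<open>(\<delta> \<otimes> id)\<delta>(x)\<close>.\<close>

definition contract2 :: "('a \<Rightarrow> 'a \<Rightarrow> 'a \<Rightarrow> 'k) \<Rightarrow> 'a \<Rightarrow> 'k" where
  "contract2 \<gamma> x = D (\<lambda>p c. D (\<lambda>a b. \<gamma> a b c) p) x"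

text \<open>
  Cocommutativity of the inner \<open>\<delta>\<close> allows exchanging the first two factors.  Coassociativity moves
  the inner \<open>\<delta>\<close> to the second factor, where cocommutativity exchanges the last two.  These two
  transpositions generate all permutations.
\<close>

lemma contract2_swap:
  assumes "trilinear_form scale \<gamma>"
  shows "contract2 (\<lambda>a b c. \<gamma> b a c) x = contract2 \<gamma> x"
    and "contract2 (\<lambda>a b c. \<gamma> a c b) x = contract2 \<gamma> x"
    and "contract2 (\<lambda>a b c. \<gamma> c b a) x = contract2 \<gamma> x"
proof -
  have left: "contract2 (\<lambda>a b c. \<gamma> b a c) x = contract2 \<gamma> x" if "trilinear_form scale \<gamma>" for \<gamma>
    using contract_flip[OF bilinear_form_slices(1)[OF that]] by (simp add: contract2_def)
  have right: "contract2 (\<lambda>a b c. \<gamma> a c b) x = contract2 \<gamma> x" if \<gamma>: "trilinear_form scale \<gamma>" for \<gamma>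
  proof -
    have "trilinear_form scale (\<lambda>a b c. \<gamma> a c b)"
      using \<gamma> by (simp add: trilinear_form_def)
    from contract_coassoc[OF this] contract_coassoc[OF \<gamma>] contract_flip[OF bilinear_form_slices(2)[OF \<gamma>]]
    show ?thesis by (simp add: contract2_def)
  qed
  show "contract2 (\<lambda>a b c. \<gamma> b a c) x = contract2 \<gamma> x" "contract2 (\<lambda>a b c. \<gamma> a c b) x = contract2 \<gamma> x"
    using left right assms by blast+
  have "trilinear_form scale (\<lambda>a b c. \<gamma> c a b)" "trilinear_form scale (\<lambda>a b c. \<gamma> b a c)"
    using assms by (simp_all add: trilinear_form_def)
  from left[OF this(1)] right[OF this(2)] left[OF assms]
  show "contract2 (\<lambda>a b c. \<gamma> c b a) x = contract2 \<gamma> x"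
    by simp
qed

text \<open>Dually: \<open>\<tau> - id\<close> kills the symmetric tensor \<open>\<delta>(x)\<close>.\<close>

lemma contract_antisymmetrized:
  assumes "bilinear_form scale \<beta>"
  shows "D (\<lambda>a b. \<beta> b a - \<beta> a b) x = 0"
proof -
  have "D (\<lambda>a b. \<beta> b a - \<beta> a b + \<beta> a b) x = D (\<lambda>a b. \<beta> b a - \<beta> a b) x + D \<beta> x"
    by (rule contract_plus_form)
  then show ?thesis using contract_flip[OF assms] by simp
qed

text \<open>
  The contraction of \<open>\<beta>\<close> with \<open>\<delta>(x\<cdot>y)\<close> is zero, and by the derivation rule it is a sum of two terms;
  cocommutativity and the sign of \<open>\<beta>\<close> turn the second one into minus the first with \<open>x\<close> and \<open>y\<close>
  exchanged.
\<close>

lemma contract_mul_swap: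
  assumes \<beta>: "bilinear_form scale \<beta>"
    and vanish: "\<And>x. D \<beta> x = 0" and alt: "\<And>a b. \<beta> a b = - \<beta> b a"
  shows "D (\<lambda>a b. \<beta> (mul a y) b) x = D (\<lambda>a b. \<beta> (mul a x) b) y"
proof -
  have "bilinear_form scale (\<lambda>a b. \<beta> a (mul x b))"
    using \<beta> by (simp add: bilinear_form_def mul_linearity)
  from contract_flip[OF this] have "D (\<lambda>a b. \<beta> a (mul x b)) y = D (\<lambda>a b. \<beta> b (mul x a)) y" by simp
  also have "\<dots> = D (\<lambda>a b. (-1) * \<beta> (mul a x) b) y"
    by (subst alt) (simp add: mul_commute)
  finally show ?thesis
    using contract_mul[OF \<beta>, of x y] unfolding vanish contract_scale_form by simp
qed

end

context nijenhuis_comm_assoc_D_bialgebra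
begin

abbreviation br where "br \<equiv> special_bracket mul N S"
abbreviation \<Delta> where "\<Delta> \<equiv> special_comul scale \<delta> S N"
abbreviation E where "E \<equiv> contract scale \<Delta>"

lemma linear_N: "Vector_Spaces.linear scale scale N"
  and linear_S: "Vector_Spaces.linear scale scale S"
  using nijenhuis_N nijenhuis_S by (simp_all add: nijenhuis_operator_def nijenhuis_cooperator_def)

lemma linearity:
  "N (x + y) = N x + N y" "N (scale c x) = scale c (N x)"
  "S (x + y) = S x + S y" "S (scale c x) = scale c (S x)"
  using linear_N linear_S by (simp_all add: Vector_Spaces.linear_iff)

lemma bilinear_form_precompose:
  assumes "bilinear_form scale \<beta>"
  shows "bilinear_form scale (\<lambda>a b. \<beta> (S a) b)" "bilinear_form scale (\<lambda>a b. \<beta> a (S b))"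
    "bilinear_form scale (\<lambda>a b. \<beta> (N a) b)" "bilinear_form scale (\<lambda>a b. \<beta> a (N b))"
    "bilinear_form scale (\<lambda>a b. \<beta> b a)"
  using assms by (simp_all add: bilinear_form_def linearity)

lemma contract_nijenhuis:
  assumes "bilinear_form scale \<beta>"
  shows "D (\<lambda>a b. \<beta> (S a) (S b)) x + D \<beta> (S (S x))
       = D (\<lambda>a b. \<beta> (S a) b) (S x) + D (\<lambda>a b. \<beta> a (S b)) (S x)"
  using nijenhuis_S assms
  unfolding nijenhuis_cooperator_def ten2_eq_iff map_append sum_list_append sum_list_map_prod prod.case
  by (simp add: contract_def)

lemma contract_adjoint:
  assumes "bilinear_form scale \<beta>"
  shows "D (\<lambda>a b. \<beta> (S a) b) (N x) + D (\<lambda>a b. \<beta> a (N (N b))) x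
       = D (\<lambda>a b. \<beta> (S a) (N b)) x + D (\<lambda>a b. \<beta> a (N b)) (N x)"
  using adjoint_comul[of x] assms
  unfolding ten2_eq_iff map_append sum_list_append sum_list_map_prod prod.case
  by (simp add: contract_def)

text \<open>
  By cocommutativity the adjointness condition holds with its two tensor factors exchanged, which
  gives the second of the two comultiplication conditions on a Nijenhuis left Alia bialgebra.
\<close>

lemma contract_adjoint_flip:
  assumes "bilinear_form scale \<beta>"
  shows "D (\<lambda>a b. \<beta> a (S b)) (N x) + D (\<lambda>a b. \<beta> (N (N a)) b) x
       = D (\<lambda>a b. \<beta> (N a) (S b)) x + D (\<lambda>a b. \<beta> (N a) b) (N x)"
proof -
  have "bilinear_form scale (\<lambda>a b. \<beta> a (S b))" "bilinear_form scale (\<lambda>a b. \<beta> (N (N a)) b)"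
    "bilinear_form scale (\<lambda>a b. \<beta> (N a) (S b))" "bilinear_form scale (\<lambda>a b. \<beta> (N a) b)"
    using assms by (simp_all add: bilinear_form_def linearity)
  from this[THEN contract_flip] contract_adjoint[OF bilinear_form_precompose(5)[OF assms], of x]
  show ?thesis by simp
qed

lemma contract_special:
  assumes "bilinear_form scale \<beta>"
  shows "E \<beta> x = D (\<lambda>a b. \<beta> a (S b)) x + D \<beta> (N x)"
  unfolding contract_def special_comul_def sum_list_sweedler_ten2[OF assms]
    map_append sum_list_append sum_list_map_prod prod.case ..

lemma comultiplication_special: "comultiplication scale \<Delta>"
  unfolding comultiplication_iff_contract
  by (auto simp: contract_special linearity contract_additive bilinear_form_precompose algebra_simps)
    (auto simp: special_comul_def tensor_square_eq_range_ten2)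

section \<open>The special left Alia bialgebra\<close>

text \<open>
  The contraction of \<open>\<gamma>\<close> with \<open>(\<delta>N \<otimes> id)\<delta>(x)\<close>.  Since \<open>N\<close> stands between the two
  comultiplications, coassociativity does not apply; cocommutativity still exchanges the first two
  factors.
\<close>

definition contract2_N :: "('a \<Rightarrow> 'a \<Rightarrow> 'a \<Rightarrow> 'k) \<Rightarrow> 'a \<Rightarrow> 'k" where
  "contract2_N \<gamma> x = D (\<lambda>p c. D (\<lambda>a b. \<gamma> a b c) (N p)) x"

lemma contract2_N_swap:
  assumes "trilinear_form scale \<gamma>"
  shows "contract2_N (\<lambda>a b c. \<gamma> b a c) x = contract2_N \<gamma> x"
  using contract_flip[OF bilinear_form_slices(1)[OF assms]] by (simp add: contract2_N_def)

lemma contract_special_twice: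
  assumes \<gamma>: "trilinear_form scale \<gamma>"
  shows "E (\<lambda>p c. E (\<lambda>a b. \<gamma> a b c) p) x
    = contract2 (\<lambda>a b c. \<gamma> a (S b) (S c)) x + contract2 (\<lambda>a b c. \<gamma> a (S b) c) (N x)
    + contract2_N (\<lambda>a b c. \<gamma> a b (S c)) x + contract2_N \<gamma> (N x)"
proof -
  have inner: "E (\<lambda>a b. \<gamma> a b c) p = D (\<lambda>a b. \<gamma> a (S b) c) p + D (\<lambda>a b. \<gamma> a b c) (N p)" for c p
    by (rule contract_special[OF bilinear_form_slices(1)[OF \<gamma>]])
  have "trilinear_form scale (\<lambda>a b c. \<gamma> a (S b) c)"
    using \<gamma> by (simp add: trilinear_form_def linearity)
  from bilinear_form_contract_slices[OF this]
    bilinear_form_precompose(3)[OF bilinear_form_contract_slices[OF \<gamma>]]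
  have "bilinear_form scale (\<lambda>p c. E (\<lambda>a b. \<gamma> a b c) p)"
    unfolding inner by (simp add: bilinear_form_def algebra_simps)
  then show ?thesis
    by (subst contract_special) (simp_all add: inner contract_plus_form contract2_def contract2_N_def)
qed

text \<open>
  The four terms of \<open>contract_special_twice\<close> are invariant under exchanging, in this order, the
  last two factors, the outer two, the first two and again the first two.  Hence in each of them
  the six signed permutations cancel in pairs.
\<close>

lemma left_alia_coalgebra_special: "left_alia_coalgebra scale \<Delta>"
proof unfold_locales
  show "comultiplication scale \<Delta>" by (rule comultiplication_special)
next
  fix x
  have key: "E (\<lambda>p c. E (\<lambda>a b. \<gamma> b a c) p) x
        + (E (\<lambda>p c. E (\<lambda>a b. \<gamma> a c b) p) x + E (\<lambda>p c. E (\<lambda>a b. \<gamma> c b a) p) x)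
      = E (\<lambda>p c. E (\<lambda>a b. \<gamma> a b c) p) x
        + (E (\<lambda>p c. E (\<lambda>a b. \<gamma> b c a) p) x + E (\<lambda>p c. E (\<lambda>a b. \<gamma> c a b) p) x)"
    if \<gamma>: "trilinear_form scale \<gamma>" for \<gamma>
  proof -
    have tri: "trilinear_form scale (\<lambda>a b c. \<gamma> b a c)" "trilinear_form scale (\<lambda>a b c. \<gamma> a c b)"
      "trilinear_form scale (\<lambda>a b c. \<gamma> c b a)" "trilinear_form scale (\<lambda>a b c. \<gamma> b c a)"
      "trilinear_form scale (\<lambda>a b c. \<gamma> c a b)"
      using \<gamma> by (simp_all add: trilinear_form_def)
    have symS: "trilinear_form scale (\<lambda>a b c. \<eta> a (S b) (S c))" "trilinear_form scale (\<lambda>a b c. \<eta> a (S b) c)"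
      "trilinear_form scale (\<lambda>a b c. \<eta> a b (S c))" if "trilinear_form scale \<eta>" for \<eta>
      using that by (simp_all add: trilinear_form_def linearity)
    have SS: "contract2 (\<lambda>a b c. \<eta> a (S c) (S b)) x = contract2 (\<lambda>a b c. \<eta> a (S b) (S c)) x"
      and S1: "contract2 (\<lambda>a b c. \<eta> c (S b) a) (N x) = contract2 (\<lambda>a b c. \<eta> a (S b) c) (N x)"
      and NS: "contract2_N (\<lambda>a b c. \<eta> b a (S c)) x = contract2_N (\<lambda>a b c. \<eta> a b (S c)) x"
      and N1: "contract2_N (\<lambda>a b c. \<eta> b a c) (N x) = contract2_N \<eta> (N x)"
      if "trilinear_form scale \<eta>" for \<eta>
      using contract2_swap(2)[OF symS(1)[OF that]] contract2_swap(3)[OF symS(2)[OF that]]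
        contract2_N_swap[OF symS(3)[OF that]] contract2_N_swap[OF that] by simp_all
    \<comment> \<open>Each transposition pairs the six permuted forms, in opposite signs; the three instances of
      each fact name one form from every pair.\<close>
    show ?thesis
      unfolding contract_special_twice[OF \<gamma>] tri[THEN contract_special_twice]
      using SS[OF \<gamma>] SS[OF tri(1)] SS[OF tri(3)] S1[OF \<gamma>] S1[OF tri(1)] S1[OF tri(2)]
        NS[OF \<gamma>] NS[OF tri(2)] NS[OF tri(3)] N1[OF \<gamma>] N1[OF tri(2)] N1[OF tri(3)]
      by simp
  qed
  show "ten3 scale
         ([(b, a, c). (p, c) \<leftarrow> sweedler scale (\<Delta> x), (a, b) \<leftarrow> sweedler scale (\<Delta> p)]
        @ [(a, c, b). (p, c) \<leftarrow> sweedler scale (\<Delta> x), (a, b) \<leftarrow> sweedler scale (\<Delta> p)]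
        @ [(c, b, a). (p, c) \<leftarrow> sweedler scale (\<Delta> x), (a, b) \<leftarrow> sweedler scale (\<Delta> p)])
       = ten3 scale
         ([(a, b, c). (p, c) \<leftarrow> sweedler scale (\<Delta> x), (a, b) \<leftarrow> sweedler scale (\<Delta> p)]
        @ [(b, c, a). (p, c) \<leftarrow> sweedler scale (\<Delta> x), (a, b) \<leftarrow> sweedler scale (\<Delta> p)]
        @ [(c, a, b). (p, c) \<leftarrow> sweedler scale (\<Delta> x), (a, b) \<leftarrow> sweedler scale (\<Delta> p)])"
    unfolding ten3_eq_iff map_append sum_list_append sum_list_nested prod.case
    using key by (simp add: contract_def)
qed

text \<open>
  The four terms of \<open>[[x, y], z]\<close> are \<open>x\<cdot>N(y)\<cdot>N(z)\<close>, \<open>S(x\<cdot>y)\<cdot>N(z)\<close>, \<open>S(x\<cdot>N(y)\<cdot>z)\<close> and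
  \<open>S(S(x\<cdot>y)\<cdot>z)\<close>; each is symmetric in two of the variables.
\<close>

lemma left_alia_algebra_special: "left_alia_algebra scale br"
proof unfold_locales
  show "bilinear_op scale br"
    unfolding bilinear_op_def Vector_Spaces.linear_iff special_bracket_def
    by (simp add: vector_space_axioms linearity mul_linearity scale_right_distrib)
  fix x y z
  have swap: "mul u (mul v w) = mul v (mul u w)" for u v w
    by (metis mul_assoc mul_commute)
  show "br (br x y) z + br (br y z) x + br (br z x) y = br (br y x) z + br (br z y) x + br (br x z) y"
    unfolding special_bracket_def
    by (simp add: linearity mul_linearity mul_assoc mul_commute swap add_ac)
qed

text \<open>
  With \<open>w = [x, y] - [y, x] = x\<cdot>N(y) - y\<cdot>N(x)\<close>, the derivation rule expands
  \<open>w\<^sub>[\<^sub>1\<^sub>] \<otimes> S(w\<^sub>[\<^sub>2\<^sub>])\<close> into four terms.  Two of them occur literally on the right-hand side; the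
  other two match after a flip, whose sign comes from the antisymmetrized form.  What remains on the
  right is zero by two instances of \<open>contract_mul_swap\<close>, one for \<open>x, y\<close> with \<open>S \<otimes> S\<close> applied to
  the tensor and one for \<open>N(x), N(y)\<close>.
\<close>

lemma special_compatible:
  "flip_minus_id scale (\<Delta> (br x y - br y x))
   = flip_minus_id scale (ten2 scale ([(br a y, b). (a, b) \<leftarrow> sweedler scale (\<Delta> x)]
                                      @ [(- br a x, b). (a, b) \<leftarrow> sweedler scale (\<Delta> y)]))"
proof -
  define w where "w = mul x (N y) - mul y (N x)"
  have w: "br x y - br y x = w"
    by (simp add: special_bracket_def w_def mul_commute)
  have key: "D (\<lambda>a b. \<beta> a (S b)) w + D \<beta> (N w)
      = E (\<lambda>a b. \<beta> (br a y) b) x + E (\<lambda>a b. \<beta> (- br a x) b) y"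
    if \<beta>: "bilinear_form scale \<beta>" and vanish: "\<And>z. D \<beta> z = 0" "\<And>z. D (\<lambda>a b. \<beta> (S a) (S b)) z = 0"
      and alt: "\<And>a b. \<beta> a b = - \<beta> b a" for \<beta>
  proof -
    have SS: "bilinear_form scale (\<lambda>a b. \<beta> (S a) (S b))"
      using \<beta> by (simp add: bilinear_form_def linearity)
    have minus: "\<beta> (- a) b = (-1) * \<beta> a b" for a b
      using \<beta> unfolding bilinear_form_def by (metis scale_minus_left scale_one)
    have R: "E (\<lambda>a b. \<beta> (br a v) b) u
        = D (\<lambda>a b. \<beta> (mul a (N v)) (S b)) u + D (\<lambda>a b. \<beta> (S (mul a v)) (S b)) u
        + D (\<lambda>a b. \<beta> (mul a (N v)) b) (N u) + D (\<lambda>a b. \<beta> (S (mul a v)) b) (N u)" for u v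
    proof -
      have bil: "bilinear_form scale (\<lambda>a b. \<beta> (mul a (N v)) b + \<beta> (S (mul a v)) b)"
        using \<beta> by (simp add: bilinear_form_def linearity mul_linearity algebra_simps)
      have "(\<lambda>a b. \<beta> (br a v) b) = (\<lambda>a b. \<beta> (mul a (N v)) b + \<beta> (S (mul a v)) b)"
        using \<beta> by (intro ext) (simp add: bilinear_form_def special_bracket_def)
      then show ?thesis
        using contract_special[OF bil, of u] by (simp add: contract_plus_form)
    qed
    have L: "D (\<lambda>a b. \<beta> a (S b)) (mul u (N v))
        = D (\<lambda>a b. \<beta> (mul a (N v)) (S b)) u - D (\<lambda>a b. \<beta> (S (mul a u)) b) (N v)" for u v
    proof -
      have "bilinear_form scale (\<lambda>a b. \<beta> (S (mul a u)) b)"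
        using \<beta> by (simp add: bilinear_form_def linearity mul_linearity)
      from contract_flip[OF this]
      have "D (\<lambda>a b. \<beta> (S (mul a u)) b) (N v) = D (\<lambda>a b. \<beta> (S (mul b u)) a) (N v)" by simp
      also have "\<dots> = D (\<lambda>a b. (-1) * \<beta> a (S (mul u b))) (N v)"
        by (subst alt) (simp add: mul_commute)
      finally show ?thesis
        using contract_mul[OF bilinear_form_precompose(2)[OF \<beta>], of u "N v"]
        unfolding contract_scale_form by simp
    qed
    have "D (\<lambda>a b. \<beta> a (S b)) (mul x (N y))
        = D (\<lambda>a b. \<beta> a (S b)) w + D (\<lambda>a b. \<beta> a (S b)) (mul y (N x))"
      using contract_additive(1)[OF bilinear_form_precompose(2)[OF \<beta>], of w "mul y (N x)"]
      by (simp add: w_def)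
    then show ?thesis
      unfolding minus contract_scale_form R vanish L
      using contract_mul_swap[OF SS vanish(2) alt, of y x]
        contract_mul_swap[OF \<beta> vanish(1) alt, of "N y" "N x"]
      by (simp add: algebra_simps)
  qed
  have Delta_w: "\<Delta> w = ten2 scale ([(a, S b). (a, b) \<leftarrow> sweedler scale (\<delta> w)]
      @ sweedler scale (\<delta> (N w)))"
    by (rule special_comul_def)
  show ?thesis
    unfolding w Delta_w flip_minus_id_ten2_eq_iff map_append sum_list_append sum_list_map_prod prod.case
  proof (intro allI impI)
    fix \<beta> assume \<beta>: "bilinear_form scale \<beta>"
    have 1: "bilinear_form scale (\<lambda>a b. \<beta> b a - \<beta> a b)"
      using \<beta> by (simp add: bilinear_form_def algebra_simps)
    have 2: "bilinear_form scale (\<lambda>a b. \<beta> (S a) (S b))"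
      using \<beta> by (simp add: bilinear_form_def linearity)
    show "(\<Sum>(a, b)\<leftarrow>sweedler scale (\<delta> w). \<beta> (S b) a - \<beta> a (S b)) +
       (\<Sum>(a, b)\<leftarrow>sweedler scale (\<delta> (N w)). \<beta> b a - \<beta> a b) =
       (\<Sum>(a, b)\<leftarrow>sweedler scale (\<Delta> x). \<beta> b (br a y) - \<beta> (br a y) b) +
       (\<Sum>(a, b)\<leftarrow>sweedler scale (\<Delta> y). \<beta> b (- br a x) - \<beta> (- br a x) b)"
      using key[OF 1 contract_antisymmetrized[OF \<beta>] contract_antisymmetrized[OF 2]]
      by (simp add: contract_def)
  qed
qed

section \<open>The Nijenhuis conditions\<close>

text \<open>
  The Nijenhuis identity of the bracket at \<open>x, y\<close> is the one of the product at \<open>x, N(y)\<close> plus \<open>S\<close>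
  of the one at \<open>x, y\<close>.  The remaining conditions split in the same way.
\<close>

lemma nijenhuis_operator_special:
  assumes comm: "\<And>x. N (S x) = S (N x)"
  shows "nijenhuis_operator scale br N"
  unfolding nijenhuis_operator_def
proof (intro conjI allI)
  fix x y
  have nij: "mul (N x) (N y) + N (N (mul x y)) = N (mul (N x) y) + N (mul x (N y))" for x y
    using nijenhuis_N by (simp add: nijenhuis_operator_def linearity)
  have "br (N x) (N y) + N (N (br x y))
      = (mul (N x) (N (N y)) + N (N (mul x (N y)))) + S (mul (N x) (N y) + N (N (mul x y)))"
    by (simp add: special_bracket_def linearity comm add_ac)
  also have "\<dots> = N (br (N x) y + br x (N y))"
    unfolding nij by (simp add: special_bracket_def linearity comm add_ac)
  finally show "br (N x) (N y) + N (N (br x y)) = N (br (N x) y + br x (N y))" .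
qed (rule linear_N)

lemma nijenhuis_cooperator_special:
  assumes comm: "\<And>x. N (S x) = S (N x)"
  shows "nijenhuis_cooperator scale \<Delta> S"
  unfolding nijenhuis_cooperator_def ten2_eq_iff map_append sum_list_append sum_list_map_prod
    prod.case contract_def[of scale \<Delta>, symmetric]
proof (intro conjI allI impI)
  fix x \<beta> assume \<beta>: "bilinear_form scale \<beta>"
  note \<beta>S = bilinear_form_precompose(2)[OF \<beta>]
  show "E (\<lambda>a b. \<beta> (S a) (S b)) x + E \<beta> (S (S x))
      = E (\<lambda>a b. \<beta> (S a) b) (S x) + E (\<lambda>a b. \<beta> a (S b)) (S x)"
    using contract_nijenhuis[OF \<beta>S, of x] contract_nijenhuis[OF \<beta>, of "N x"]
    by (simp add: contract_special bilinear_form_precompose \<beta>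
        bilinear_form_precompose(1)[OF \<beta>S] comm algebra_simps)
qed (rule linear_S)

lemma adjoint_br_left_special:
  assumes comm: "\<And>x. N (S x) = S (N x)"
  shows "S (br (N x) y) + br x (S (S y)) = S (br x (S y)) + br (N x) (S y)"
proof -
  have "S (br (N x) y) + br x (S (S y))
      = (S (mul (N x) (N y)) + mul x (S (S (N y)))) + S (S (mul (N x) y) + mul x (S (S y)))"
    by (simp add: special_bracket_def linearity comm add_ac)
  also have "\<dots> = S (br x (S y)) + br (N x) (S y)"
    unfolding adjoint_mul by (simp add: special_bracket_def linearity comm add_ac)
  finally show ?thesis .
qed

lemma adjoint_br_right_special:
  "S (br x (N y)) + br (S (S x)) y = S (br (S x) y) + br (S x) (N y)"
proof -
  have adj: "S (mul u (N v)) + mul (S (S u)) v = mul (S u) (N v) + S (mul (S u) v)" for u v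
    using adjoint_mul[of v u] by (simp add: mul_commute)
  have "S (br x (N y)) + br (S (S x)) y
      = (S (mul x (N (N y))) + mul (S (S x)) (N y)) + S (S (mul x (N y)) + mul (S (S x)) y)"
    by (simp add: special_bracket_def linearity add_ac)
  also have "\<dots> = S (br (S x) y) + br (S x) (N y)"
    unfolding adj by (simp add: special_bracket_def linearity add_ac)
  finally show ?thesis .
qed

lemma adjoint_comul_left_special:
  assumes comm: "\<And>x. N (S x) = S (N x)"
  shows "ten2 scale ([(S a, b). (a, b) \<leftarrow> sweedler scale (\<Delta> (N x))]
                   @ [(a, N (N b)). (a, b) \<leftarrow> sweedler scale (\<Delta> x)])
       = ten2 scale ([(S a, N b). (a, b) \<leftarrow> sweedler scale (\<Delta> x)]
                   @ [(a, N b). (a, b) \<leftarrow> sweedler scale (\<Delta> (N x))])"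
  unfolding ten2_eq_iff map_append sum_list_append sum_list_map_prod
    prod.case contract_def[of scale \<Delta>, symmetric]
proof (intro allI impI)
  fix \<beta> assume \<beta>: "bilinear_form scale \<beta>"
  have bil: "bilinear_form scale (\<lambda>a b. \<beta> (S a) b)" "bilinear_form scale (\<lambda>a b. \<beta> a (N (N b)))"
    "bilinear_form scale (\<lambda>a b. \<beta> (S a) (N b))" "bilinear_form scale (\<lambda>a b. \<beta> a (N b))"
    using \<beta> by (simp_all add: bilinear_form_def linearity)
  show "E (\<lambda>a b. \<beta> (S a) b) (N x) + E (\<lambda>a b. \<beta> a (N (N b))) x
      = E (\<lambda>a b. \<beta> (S a) (N b)) x + E (\<lambda>a b. \<beta> a (N b)) (N x)"
    unfolding bil[THEN contract_special]
    using contract_adjoint[OF bilinear_form_precompose(2)[OF \<beta>], of x] contract_adjoint[OF \<beta>, of "N x"]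
    by (simp add: comm algebra_simps)
qed

lemma adjoint_comul_right_special:
  "ten2 scale ([(a, S b). (a, b) \<leftarrow> sweedler scale (\<Delta> (N x))]
                   @ [(N (N a), b). (a, b) \<leftarrow> sweedler scale (\<Delta> x)])
       = ten2 scale ([(N a, S b). (a, b) \<leftarrow> sweedler scale (\<Delta> x)]
                   @ [(N a, b). (a, b) \<leftarrow> sweedler scale (\<Delta> (N x))])"
  unfolding ten2_eq_iff map_append sum_list_append sum_list_map_prod
    prod.case contract_def[of scale \<Delta>, symmetric]
proof (intro allI impI)
  fix \<beta> assume \<beta>: "bilinear_form scale \<beta>"
  have bil: "bilinear_form scale (\<lambda>a b. \<beta> a (S b))" "bilinear_form scale (\<lambda>a b. \<beta> (N (N a)) b)"
    "bilinear_form scale (\<lambda>a b. \<beta> (N a) (S b))" "bilinear_form scale (\<lambda>a b. \<beta> (N a) b)"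
    using \<beta> by (simp_all add: bilinear_form_def linearity)
  show "E (\<lambda>a b. \<beta> a (S b)) (N x) + E (\<lambda>a b. \<beta> (N (N a)) b) x
      = E (\<lambda>a b. \<beta> (N a) (S b)) x + E (\<lambda>a b. \<beta> (N a) b) (N x)"
    unfolding bil[THEN contract_special]
    using contract_adjoint_flip[OF bilinear_form_precompose(2)[OF \<beta>], of x] contract_adjoint_flip[OF \<beta>, of "N x"]
    by (simp add: algebra_simps)
qed

end

theorem corollary4p9:
  fixes scale :: "'k::field_char_0 \<Rightarrow> 'a::ab_group_add \<Rightarrow> 'a"
    and mul :: "'a \<Rightarrow> 'a \<Rightarrow> 'a"
    and \<delta> :: "'a \<Rightarrow> ('k, 'a) tensor2"
    and f g :: "'a \<Rightarrow> 'a"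
  assumes "nijenhuis_comm_assoc_D_bialgebra scale mul \<delta> f g"
    and "f \<circ> g = g \<circ> f"
  shows "nijenhuis_left_alia_bialgebra scale
           (special_bracket mul f g) (special_comul scale \<delta> g f) f g"
proof -
  interpret nijenhuis_comm_assoc_D_bialgebra scale mul \<delta> f g by fact
  have comm: "f (g x) = g (f x)" for x
    using assms(2) by (simp add: fun_eq_iff)
  interpret left_alia_algebra scale br by (rule left_alia_algebra_special)
  interpret left_alia_coalgebra scale \<Delta> by (rule left_alia_coalgebra_special)
  show ?thesis
    by unfold_locales
      (rule special_compatible nijenhuis_operator_special[OF comm] nijenhuis_cooperator_special[OF comm]
        adjoint_br_left_special[OF comm] adjoint_br_right_special
        adjoint_comul_left_special[OF comm] adjoint_comul_right_special)+
qed

end
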